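(* For every $0\le\beta\le2$ there exists a Lévy measure $\nu_\beta$ on $\mathbb{R}^2$ with Blumenthal–Getoor index $\beta$ such that $\nu=\nu_\beta$ satisfies all of the following, where $U_1(x)=\nu([x,\infty)\times[0,\infty))$ and $U_2(y)=\nu([0,\infty)\times[y,\infty))$: (i) $\nu(\mathbb{R}^2\setminus[0,\infty)^2)=0$; (ii) there is $\gamma>0$ with $\int|x|^{8+\gamma}\,\nu(dx)<\infty$; (iii) there is $c>0$ with $|\mathcal{F}((x_1^4+x_2^4)\nu)(u)|\le c\,(1+|u_1|)^{-1}(1+|u_2|)^{-1}$ for all $u=(u_1,u_2)\in\mathbb{R}^2$; (iv) for $k=1,2$, $U_k:(0,\infty)\to(0,\infty)$ is a $\mathcal{C}^1$-bijection with $U_k'<0$, $\inf_{0<x\le1}|U_k'(x)|>0$ and $\sup_{x>0}(1\wedge x^3)|U_k'(x)|<\infty$.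
   Context: A Lévy measure on $\mathbb{R}^2$ is a Borel measure $\nu$ with $\nu(\{0\})=0$ and $\int(|x|^2\wedge1)\,\nu(dx)<\infty$. Its Blumenthal–Getoor index is $\inf\{p\ge0:\int_{\{|x|\le1\}}|x|^p\,\nu(dx)<\infty\}$. For a finite measure $\mu$ on $\mathbb{R}^2$, $(\mathcal{F}\mu)(u)=\int e^{i\langle u,x\rangle}\mu(dx)$; $(x_1^4+x_2^4)\nu$ denotes the measure with $\nu$-density $x_1^4+x_2^4$. *)

theory Defs
  imports "HOL-Probability.Probability"
begin

definition levy_measure :: "'a::euclidean_space measure \<Rightarrow> bool" where
  "levy_measure \<nu> \<longleftrightarrow> sets \<nu> = sets borel \<and> emeasure \<nu> {0} = 0 \<and>
     (\<integral>\<^sup>+ x. ennreal (min ((norm x)\<^sup>2) 1) \<partial>\<nu>) < \<infinity>"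

text \<open>For \<open>p = 0\<close> the integrand is \<open>1\<close> except at the origin (\<open>0 powr 0 = 0\<close>), which is null for
  every Levy measure. For a Levy measure the set below contains \<open>2\<close> and is bounded below by \<open>0\<close>,
  so the real infimum is the true one.\<close>

definition blumenthal_getoor_index :: "'a::euclidean_space measure \<Rightarrow> real" where
  "blumenthal_getoor_index \<nu> =
     Inf {p. 0 \<le> p \<and> (\<integral>\<^sup>+ x \<in> {x. norm x \<le> 1}. ennreal (norm x powr p) \<partial>\<nu>) < \<infinity>}"

text \<open>Only meaningful for finite measures: otherwise the Bochner integral is \<open>0\<close> by convention.\<close>

definition fourier :: "'a::euclidean_space measure \<Rightarrow> 'a \<Rightarrow> complex" where
  "fourier \<mu> u = (\<integral>x. exp (\<i> * complex_of_real (u \<bullet> x)) \<partial>\<mu>)"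

text \<open>\<open>measure\<close> sends infinite mass to \<open>0\<close>; the tails of a Levy measure are finite at arguments
  \<open>> 0\<close>, the only ones that matter.\<close>

definition U1 :: "(real \<times> real) measure \<Rightarrow> real \<Rightarrow> real" where
  "U1 \<nu> x = measure \<nu> ({x..} \<times> {0..})"

definition U2 :: "(real \<times> real) measure \<Rightarrow> real \<Rightarrow> real" where
  "U2 \<nu> y = measure \<nu> ({0..} \<times> {y..})"

end

theory Submission
  imports Defs "HOL-Real_Asymp.Real_Asymp"
begin

text \<open>
  Let \<open>P\<close> be the law of two independent standard exponential variables and
  \<open>\<nu> = \<Sum>n. a n * P\<^sub>n\<close>, where \<open>P\<^sub>n\<close> is the image of \<open>P\<close> under \<open>z \<mapsto> z / 2 ^ n\<close>. A moment of
  order \<open>p\<close> near the origin is comparable to \<open>\<Sum> a n * 2 ^ (- n * p)\<close>, so the weights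
  \<open>a n = (2 ^ n / (n + 1)) powr \<beta>\<close> give index \<open>\<beta>\<close>; the factor \<open>(n + 1) powr - \<beta>\<close> makes
  \<open>\<Sum> a n / 4 ^ n\<close> converge also for \<open>\<beta> = 2\<close> without destroying \<open>\<Sum> a n = \<infinity>\<close> for \<open>\<beta> = 0\<close>.
  Both tails equal \<open>\<Sum> a n * exp (- (2 ^ n * x))\<close>. The Fourier transform of \<open>x ^ k\<close> times the
  exponential density is \<open>O (1 / (1 + \<bar>u\<bar>))\<close>, hence the \<open>n\<close>-th term of (iii) is at most
  \<open>a n * 16 ^ (- n)\<close> times \<open>1 / ((1 + \<bar>u\<^sub>1\<bar> / 2 ^ n) * (1 + \<bar>u\<^sub>2\<bar> / 2 ^ n))\<close> up to a constant,
  which is again controlled by \<open>\<Sum> a n / 4 ^ n\<close>.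
\<close>

section \<open>The product exponential law, its moments, and dyadic mixtures of it\<close>

definition std_exp :: "real measure" where
  "std_exp = density lborel (exponential_density 1)"

definition std_exp2 :: "(real \<times> real) measure" where
  "std_exp2 = std_exp \<Otimes>\<^sub>M std_exp"

text \<open>Encoded as one pushforward from the product of counting measure with
  \<open>std_exp2\<close>, instead of a sum of measures, so that change of variables and Fubini
  serve nonnegative and complex integrands alike.\<close>

definition dyadic_mixture :: "(nat \<Rightarrow> real) \<Rightarrow> (real \<times> real) measure" where
  "dyadic_mixture a =
     distr (density (count_space UNIV \<Otimes>\<^sub>M std_exp2) (\<lambda>w. ennreal (a (fst w)))) borel
       (\<lambda>w. snd w /\<^sub>R 2 ^ fst w)"

lemma sets_std_exp [measurable_cong, simp]: "sets std_exp = sets borel"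
  by (simp add: std_exp_def)

lemma space_std_exp [simp]: "space std_exp = UNIV"
  by (simp add: std_exp_def)

lemma prob_space_std_exp: "prob_space std_exp"
  unfolding std_exp_def by (rule prob_space_exponential_density) simp

lemma sets_std_exp2 [measurable_cong, simp]: "sets std_exp2 = sets borel"
  unfolding std_exp2_def by (metis borel_prod sets_pair_measure_cong sets_std_exp)

lemma space_std_exp2 [simp]: "space std_exp2 = UNIV"
  by (simp add: std_exp2_def space_pair_measure)

interpretation std_exp: prob_space std_exp
  by (rule prob_space_std_exp)

interpretation std_exp_pair: pair_prob_space std_exp std_exp ..

interpretation std_exp2: prob_space std_exp2
  unfolding std_exp2_def by (rule std_exp_pair.prob_space_axioms)

interpretation count: sigma_finite_measure "count_space (UNIV :: nat set)"
  by (rule sigma_finite_measure_count_space)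

interpretation count_exp2: pair_sigma_finite "count_space (UNIV :: nat set)" std_exp2 ..

lemma nn_integral_std_exp:
  assumes [measurable]: "f \<in> borel_measurable borel"
  shows "(\<integral>\<^sup>+ x. f x \<partial>std_exp) = (\<integral>\<^sup>+ x. ennreal (exp (- x)) * f x * indicator {0..} x \<partial>lborel)"
  unfolding std_exp_def
  by (subst nn_integral_density) (auto intro!: nn_integral_cong simp: exponential_density_def indicator_def)

lemma emeasure_std_exp_atLeast:
  assumes "0 \<le> a"
  shows "emeasure std_exp {a..} = ennreal (exp (- a))"
proof -
  have "emeasure std_exp {a..} = (\<integral>\<^sup>+ x. indicator {a..} x \<partial>std_exp)"
    by simp
  also have "\<dots> = (\<integral>\<^sup>+ x. ennreal (exp (- x)) * indicator {a..} x \<partial>lborel)"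
    by (subst nn_integral_std_exp) (use assms in \<open>auto intro!: nn_integral_cong simp: indicator_def\<close>)
  also have "\<dots> = 0 - (- exp (- a))"
    by (rule nn_integral_FTC_atLeast) (auto intro!: derivative_eq_intros, real_asymp)
  finally show ?thesis by simp
qed

lemma emeasure_std_exp2_Times:
  "A \<in> sets borel \<Longrightarrow> B \<in> sets borel \<Longrightarrow>
    emeasure std_exp2 (A \<times> B) = emeasure std_exp A * emeasure std_exp B"
  unfolding std_exp2_def by (rule std_exp.emeasure_pair_measure_Times) auto

text \<open>The rate 1/2 stays below the rate 1 of the law, so this exponential moment is finite; it
  dominates all power moments.\<close>

lemma nn_integral_std_exp_exp_half: "(\<integral>\<^sup>+ x. ennreal (exp (\<bar>x\<bar> / 2)) \<partial>std_exp) = 2"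
proof -
  have "(\<integral>\<^sup>+ x. ennreal (exp (\<bar>x\<bar> / 2)) \<partial>std_exp) =
      (\<integral>\<^sup>+ x. ennreal (exp (- x / 2)) * indicator {0..} x \<partial>lborel)"
    by (subst nn_integral_std_exp)
      (auto intro!: nn_integral_cong simp: indicator_def ennreal_mult[symmetric] exp_add[symmetric])
  also have "\<dots> = ennreal (0 - (- 2 * exp (- 0 / 2)))"
    by (rule nn_integral_FTC_atLeast) (auto intro!: derivative_eq_intros, real_asymp)
  finally show ?thesis by simp
qed

text \<open>A single term of the exponential series is at most the whole series.\<close>

lemma power_le_fact_exp:
  fixes t :: real
  assumes "0 \<le> t"
  shows "t ^ k \<le> fact k * exp t"
proof -
  have "t ^ k / fact k \<le> (\<Sum>n. t ^ n / fact n)"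
    by (rule order_trans[OF _ sum_le_suminf[where I="{k}"]])
      (use assms summable_exp[of t] in \<open>auto simp: divide_inverse mult.commute\<close>)
  also have "\<dots> = exp t"
    by (simp add: exp_def divide_inverse mult.commute)
  finally show ?thesis
    by (simp add: field_simps)
qed

lemma powr_le_exp_half:
  fixes p :: real
  assumes "0 \<le> p"
  obtains C where "\<And>t. 0 \<le> t \<Longrightarrow> t powr p \<le> C * exp (t / 2)" "C > 0"
proof
  define k where "k = nat \<lceil>p\<rceil>"
  show "t powr p \<le> (1 + 2 ^ k * fact k) * exp (t / 2)" if t: "0 \<le> t" for t
  proof -
    \<comment> \<open>The real exponent is rounded up to \<open>k\<close>: the summand 1 covers
      \<open>t \<le> 1\<close>, the power covers \<open>t > 1\<close>.\<close>
    have "t powr p \<le> 1 + t ^ k"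
    proof (cases "t \<le> 1")
      case True
      then have "t powr p \<le> 1 powr p"
        using t assms by (intro powr_mono2) auto
      then show ?thesis using t by (simp add: add_increasing2)
    next
      case False
      then have "t powr p \<le> t powr real k"
        using real_nat_ceiling_ge[of p] by (intro powr_mono) (auto simp: k_def)
      then show ?thesis using False by (simp add: powr_realpow)
    qed
    also have "1 \<le> exp (t / 2)" using t by simp
    also have "t ^ k = 2 ^ k * (t / 2) ^ k"
      by (simp add: power_divide)
    also have "\<dots> \<le> 2 ^ k * (fact k * exp (t / 2))"
      using t by (intro mult_left_mono power_le_fact_exp) auto
    finally show ?thesis by (simp add: algebra_simps)
  qed
qed (simp add: add_pos_nonneg)

text \<open>Since the norm is at most the sum of the absolute coordinates, its exponential splits
  into a product, and Tonelli reduces the bound to the one-dimensional exponential moment.\<close>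

lemma std_exp2_moment_finite:
  assumes "0 \<le> p"
  shows "(\<integral>\<^sup>+ z. ennreal (norm z powr p) \<partial>std_exp2) < \<infinity>"
proof -
  obtain C where C: "\<And>t. 0 \<le> t \<Longrightarrow> t powr p \<le> C * exp (t / 2)" "C > 0"
    using powr_le_exp_half[OF assms] by metis
  have "(\<integral>\<^sup>+ z. ennreal (norm z powr p) \<partial>std_exp2) \<le>
      (\<integral>\<^sup>+ z. ennreal C * (ennreal (exp (\<bar>fst z\<bar> / 2)) * ennreal (exp (\<bar>snd z\<bar> / 2))) \<partial>std_exp2)"
  proof (intro nn_integral_mono)
    fix z :: "real \<times> real"
    have "norm z \<le> \<bar>fst z\<bar> + \<bar>snd z\<bar>"
      using norm_Pair_le[of "fst z" "snd z"] by simp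
    then have "exp (norm z / 2) \<le> exp (\<bar>fst z\<bar> / 2) * exp (\<bar>snd z\<bar> / 2)"
      by (simp flip: exp_add)
    then have "norm z powr p \<le> C * (exp (\<bar>fst z\<bar> / 2) * exp (\<bar>snd z\<bar> / 2))"
      using C(1)[of "norm z"] C(2) by (meson norm_ge_zero mult_left_mono less_imp_le order_trans)
    then show "ennreal (norm z powr p) \<le>
        ennreal C * (ennreal (exp (\<bar>fst z\<bar> / 2)) * ennreal (exp (\<bar>snd z\<bar> / 2)))"
      using C(2) by (simp flip: ennreal_mult)
  qed
  also have "\<dots> = ennreal C * (\<integral>\<^sup>+ x. (\<integral>\<^sup>+ y. ennreal (exp (\<bar>x\<bar> / 2)) * ennreal (exp (\<bar>y\<bar> / 2)) \<partial>std_exp) \<partial>std_exp)"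
    unfolding std_exp2_def
    by (subst nn_integral_cmult, measurable, subst std_exp.nn_integral_fst[symmetric]) auto
  also have "\<dots> = ennreal C * (2 * 2)"
    by (simp add: nn_integral_cmult nn_integral_multc nn_integral_std_exp_exp_half)
  also have "\<dots> < \<infinity>"
    by (simp add: ennreal_mult_less_top)
  finally show ?thesis .
qed

lemma nn_integral_dyadic_mixture:
  assumes [measurable]: "f \<in> borel_measurable borel"
  shows "(\<integral>\<^sup>+ z. f z \<partial>dyadic_mixture a) =
    (\<Sum>n. ennreal (a n) * (\<integral>\<^sup>+ z. f (z /\<^sub>R 2 ^ n) \<partial>std_exp2))"
proof -
  have [measurable]: "(\<lambda>w. snd w /\<^sub>R 2 ^ fst w) \<in> count_space (UNIV :: nat set) \<Otimes>\<^sub>M std_exp2 \<rightarrow>\<^sub>M borel"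
    by measurable
  have "(\<integral>\<^sup>+ z. f z \<partial>dyadic_mixture a) =
      (\<integral>\<^sup>+ w. ennreal (a (fst w)) * f (snd w /\<^sub>R 2 ^ fst w) \<partial>(count_space UNIV \<Otimes>\<^sub>M std_exp2))"
    unfolding dyadic_mixture_def
    by (subst nn_integral_distr, simp, simp, subst nn_integral_density) auto
  also have "\<dots> = (\<integral>\<^sup>+ n. (\<integral>\<^sup>+ z. ennreal (a n) * f (z /\<^sub>R 2 ^ n) \<partial>std_exp2) \<partial>count_space UNIV)"
    by (subst std_exp2.nn_integral_fst[symmetric]) auto
  also have "\<dots> = (\<Sum>n. ennreal (a n) * (\<integral>\<^sup>+ z. f (z /\<^sub>R 2 ^ n) \<partial>std_exp2))"
    by (simp add: nn_integral_count_space_nat nn_integral_cmult)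
  finally show ?thesis .
qed

subsection \<open>Series of exponentials\<close>

lemma exp_minus_le_fact_div_power:
  fixes t :: real
  assumes "0 < t"
  shows "exp (- t) \<le> fact k / t ^ k"
  using power_le_fact_exp[of t k] assms by (simp add: exp_minus field_simps)

text \<open>One power of \<open>2 ^ n * x\<close> more than the growth of \<open>b\<close> is spent
  on the exponential, which leaves a geometric factor.\<close>

lemma dyadic_exp_term_le:
  fixes x :: real
  assumes "0 < x" "0 \<le> b" "b \<le> 2 ^ (k * n)"
  shows "b * exp (- (2 ^ n * x)) \<le> fact (Suc k) / x ^ Suc k * (1 / 2) ^ n"
proof -
  have "b * exp (- (2 ^ n * x)) \<le> 2 ^ (k * n) * (fact (Suc k) / (2 ^ n * x) ^ Suc k)"
    using assms by (intro mult_mono exp_minus_le_fact_div_power) auto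
  also have "\<dots> = fact (Suc k) / x ^ Suc k * (1 / 2) ^ n"
    using assms by (simp add: power_mult_distrib power_mult[symmetric] power_add field_simps del: fact_Suc)
  finally show ?thesis .
qed

lemma summable_dyadic_exp_series:
  fixes x :: real
  assumes "0 < x" "\<And>n. 0 \<le> b n" "\<And>n. b n \<le> 2 ^ (k * n)"
  shows "summable (\<lambda>n. b n * exp (- (2 ^ n * x)))"
proof (rule summable_comparison_test')
  show "summable (\<lambda>n. fact (Suc k) / x ^ Suc k * (1 / 2) ^ n)"
    by (intro summable_mult summable_geometric) auto
  show "norm (b n * exp (- (2 ^ n * x))) \<le> fact (Suc k) / x ^ Suc k * (1 / 2) ^ n" if "n \<ge> 0" for n
    using dyadic_exp_term_le[OF assms(1) assms(2,3)[of n]] assms(2)[of n] by (simp add: abs_mult del: fact_Suc)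
qed

text \<open>Termwise differentiation on the half-line beyond \<open>x / 2\<close>: every term of the
  derivative series is largest in absolute value at \<open>x / 2\<close>, so its values there serve
  as Weierstrass majorants. The derivative series has the same shape with growth exponent
  \<open>Suc k\<close>, so the lemma can be applied again.\<close>

lemma has_field_derivative_dyadic_exp_series:
  fixes x :: real
  assumes x: "0 < x" and b: "\<And>n. 0 \<le> b n" "\<And>n. b n \<le> 2 ^ (k * n)"
  shows "((\<lambda>x. \<Sum>n. b n * exp (- (2 ^ n * x))) has_field_derivative
    - (\<Sum>n. (b n * 2 ^ n) * exp (- (2 ^ n * x)))) (at x)"
proof -
  have b': "0 \<le> b n * 2 ^ n" "b n * 2 ^ n \<le> 2 ^ (Suc k * n)" for n
    using b[of n] by (auto simp: power_add)
  have "((\<lambda>x. \<Sum>n. b n * exp (- (2 ^ n * x))) has_field_derivative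
      (\<Sum>n. - ((b n * 2 ^ n) * exp (- (2 ^ n * x))))) (at x)"
  proof (rule has_field_derivative_series'(2)[where S="{x / 2<..}" and x0=x])
    show "((\<lambda>y. b n * exp (- (2 ^ n * y))) has_field_derivative
        - (b n * 2 ^ n * exp (- (2 ^ n * y)))) (at y within {x / 2<..})" for n y
      by (auto intro!: derivative_eq_intros)
    show "uniformly_convergent_on {x / 2<..} (\<lambda>n y. \<Sum>i<n. - (b i * 2 ^ i * exp (- (2 ^ i * y))))"
    proof (rule Weierstrass_m_test'_ev)
      show "summable (\<lambda>n. (b n * 2 ^ n) * exp (- (2 ^ n * (x / 2))))"
        using x b' by (intro summable_dyadic_exp_series[where k="Suc k"]) auto
      show "\<forall>\<^sub>F n in sequentially. \<forall>y\<in>{x / 2<..}. norm (- (b n * 2 ^ n * exp (- (2 ^ n * y))))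
          \<le> (b n * 2 ^ n) * exp (- (2 ^ n * (x / 2)))"
        using b by (auto simp: abs_mult intro!: always_eventually mult_left_mono)
    qed
    show "summable (\<lambda>n. b n * exp (- (2 ^ n * x)))"
      using x b by (rule summable_dyadic_exp_series)
  qed (use x in \<open>auto simp: interior_open\<close>)
  then show ?thesis
    using summable_dyadic_exp_series[OF x b'] by (simp add: suminf_minus)
qed

section \<open>Analytic properties of the tail functions\<close>

text \<open>\<open>U\<close> is prescribed only for positive arguments: at 0 the series diverges,
  because all weights are at least 1.\<close>

locale dyadic_tail =
  fixes a :: "nat \<Rightarrow> real" and U :: "real \<Rightarrow> real"
  assumes a_ge: "1 \<le> a n"
    and a_summable: "summable (\<lambda>n. a n / 4 ^ n)"
    and a_le: "a n \<le> 4 ^ n"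
    and U_eq: "0 < x \<Longrightarrow> U x = (\<Sum>n. a n * exp (- (2 ^ n * x)))"
begin

lemma a_nonneg: "0 \<le> a n"
  using a_ge[of n] by simp

lemma a_le': "a n \<le> 2 ^ (2 * n)" "a n * 2 ^ n \<le> 2 ^ (3 * n)"
proof -
  show "a n \<le> 2 ^ (2 * n)"
    using a_le[of n] by (simp add: power_mult)
  have "a n * 2 ^ n \<le> 4 ^ n * 2 ^ n"
    using a_le[of n] by simp
  also have "\<dots> = 2 ^ (3 * n)"
    by (simp add: power_mult flip: power_mult_distrib)
  finally show "a n * 2 ^ n \<le> 2 ^ (3 * n)" .
qed

lemma U_summable: "0 < x \<Longrightarrow> summable (\<lambda>n. a n * exp (- (2 ^ n * x)))"
  using a_nonneg a_le'(1) by (intro summable_dyadic_exp_series)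

lemma dU_summable: "0 < x \<Longrightarrow> summable (\<lambda>n. (a n * 2 ^ n) * exp (- (2 ^ n * x)))"
  using a_nonneg a_le'(2) by (intro summable_dyadic_exp_series) auto

text \<open>\<open>U\<close> agrees with the series on a whole neighbourhood of \<open>x\<close>, so
  the derivative carries over.\<close>

lemma U_has_derivative:
  assumes "0 < x"
  shows "(U has_field_derivative - (\<Sum>n. (a n * 2 ^ n) * exp (- (2 ^ n * x)))) (at x)"
proof -
  have "eventually (\<lambda>y. y \<in> {0<..}) (nhds x)"
    by (rule eventually_nhds_in_open) (use assms in auto)
  then have "eventually (\<lambda>y. U y = (\<Sum>n. a n * exp (- (2 ^ n * y)))) (nhds x)"
    by eventually_elim (simp add: U_eq)
  with has_field_derivative_dyadic_exp_series[OF assms a_nonneg a_le'(1)]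
  show ?thesis
    by (subst DERIV_cong_ev) auto
qed

lemma deriv_U: "0 < x \<Longrightarrow> deriv U x = - (\<Sum>n. (a n * 2 ^ n) * exp (- (2 ^ n * x)))"
  by (rule DERIV_imp_deriv[OF U_has_derivative])

text \<open>The term \<open>n = 0\<close> alone gives the bound, as \<open>a 0\<close> is at least
  1. This yields both the sign of the derivative and the infimum \<open>exp (- 1)\<close> on the
  unit interval.\<close>

lemma deriv_U_le: "0 < x \<Longrightarrow> deriv U x \<le> - exp (- x)"
proof -
  assume x: "0 < x"
  have "exp (- x) \<le> (a 0 * 2 ^ 0) * exp (- (2 ^ 0 * x))"
    using a_ge[of 0] by simp
  also have "\<dots> \<le> (\<Sum>n. (a n * 2 ^ n) * exp (- (2 ^ n * x)))"
    using sum_le_suminf[OF dU_summable[OF x], of "{0}"] a_nonneg by auto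
  finally show ?thesis using deriv_U[OF x] by simp
qed

lemma deriv_U_neg: "0 < x \<Longrightarrow> deriv U x < 0"
  using deriv_U_le[of x] exp_gt_zero[of "- x"] by linarith

text \<open>The derivative series is again a series of exponentials, with growth exponent 3, hence
  differentiable.\<close>

lemma continuous_deriv_U: "continuous_on {0<..} (deriv U)"
proof -
  have "continuous_on {0<..} (\<lambda>x. - (\<Sum>n. (a n * 2 ^ n) * exp (- (2 ^ n * x))))"
    by (intro continuous_on_minus continuous_at_imp_continuous_on ballI
        DERIV_isCont[OF has_field_derivative_dyadic_exp_series[where k=3]])
      (use a_nonneg a_le'(2) in auto)
  then show ?thesis
    by (rule continuous_on_eq) (simp add: deriv_U)
qed

lemma Inf_deriv_U: "(INF x\<in>{0<..1}. \<bar>deriv U x\<bar>) > 0"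
proof -
  have "exp (- 1) \<le> (INF x\<in>{0<..1}. \<bar>deriv U x\<bar>)"
  proof (rule cINF_greatest)
    fix x :: real assume x: "x \<in> {0<..1}"
    then have "exp (- 1) \<le> exp (- x)" "deriv U x \<le> - exp (- x)"
      by (auto intro!: deriv_U_le)
    then show "exp (- 1) \<le> \<bar>deriv U x\<bar>" by linarith
  qed auto
  then show ?thesis using exp_gt_zero[of "- 1 :: real"] by linarith
qed

text \<open>With \<open>exp (- t) \<le> 3! / t ^ 3\<close> at \<open>t = 2 ^ n * x\<close> the
  factor \<open>x ^ 3\<close> cancels, and \<open>2 ^ n / 8 ^ n\<close> leaves exactly the summable
  \<open>a n / 4 ^ n\<close>.\<close>

lemma bounded_deriv_U: "bdd_above ((\<lambda>x. min 1 (x ^ 3) * \<bar>deriv U x\<bar>) ` {0<..})"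
proof (rule bdd_aboveI2)
  fix x :: real assume "x \<in> {0<..}"
  then have x: "0 < x" by simp
  have "x ^ 3 * ((a n * 2 ^ n) * exp (- (2 ^ n * x))) \<le> 6 * (a n / 4 ^ n)" for n
  proof -
    have "x ^ 3 * ((a n * 2 ^ n) * exp (- (2 ^ n * x))) \<le> x ^ 3 * ((a n * 2 ^ n) * (fact 3 / (2 ^ n * x) ^ 3))"
      using x a_nonneg[of n] by (intro mult_left_mono exp_minus_le_fact_div_power) auto
    also have "\<dots> = 6 * (a n / (2 ^ n * 2 ^ n))"
      using x by (simp add: field_simps power3_eq_cube fact_numeral)
    also have "\<dots> = 6 * (a n / 4 ^ n)"
      by (simp flip: power_mult_distrib)
    finally show ?thesis .
  qed
  then have "(\<Sum>n. x ^ 3 * ((a n * 2 ^ n) * exp (- (2 ^ n * x)))) \<le> (\<Sum>n. 6 * (a n / 4 ^ n))"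
    by (intro suminf_le summable_mult a_summable dU_summable x)
  then have "x ^ 3 * \<bar>deriv U x\<bar> \<le> 6 * (\<Sum>n. a n / 4 ^ n)"
    using deriv_U[OF x] deriv_U_neg[OF x] x
    by (simp add: suminf_mult[OF dU_summable] suminf_mult[OF a_summable] del: times_divide_eq_right)
  \<comment> \<open>The bound by \<open>x ^ 3\<close> holds on the whole half-line, so the minimum
    can simply be dropped.\<close>
  moreover have "min 1 (x ^ 3) * \<bar>deriv U x\<bar> \<le> x ^ 3 * \<bar>deriv U x\<bar>"
    by (intro mult_right_mono) auto
  ultimately show "min 1 (x ^ 3) * \<bar>deriv U x\<bar> \<le> 6 * (\<Sum>n. a n / 4 ^ n)"
    by linarith
qed

lemma U_strict_antimono:
  assumes "0 < x" "x < y"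
  shows "U y < U x"
proof (rule DERIV_neg_imp_decreasing[OF assms(2)])
  fix t assume "x \<le> t"
  then have "0 < t" using assms by simp
  then show "\<exists>d. DERIV U t :> d \<and> d < 0"
    using U_has_derivative[of t] deriv_U_neg[of t] deriv_U[of t] by auto
qed

lemma U_pos: "0 < x \<Longrightarrow> 0 < U x"
  using a_ge less_le_trans[OF zero_less_one a_ge]
  by (simp add: U_eq suminf_pos U_summable)

text \<open>Supplies the decay at infinity for surjectivity; 12 is \<open>3!\<close> times the sum 2
  of the geometric series.\<close>

lemma U_le: "0 < x \<Longrightarrow> U x \<le> 12 / x ^ 3"
proof -
  assume x: "0 < x"
  have "U x \<le> (\<Sum>n. fact (Suc 2) / x ^ Suc 2 * (1 / 2) ^ n)"
    unfolding U_eq[OF x]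
    by (intro suminf_le dyadic_exp_term_le x a_nonneg a_le' U_summable summable_mult summable_geometric) auto
  also have "\<dots> = 12 / x ^ 3"
    by (subst suminf_mult) (auto simp: suminf_geometric fact_numeral power3_eq_cube)
  finally show ?thesis .
qed

text \<open>As \<open>x\<close> decreases to 0, the first \<open>N\<close> exponentials tend to 1
  each; with weights at least 1 the series therefore exceeds any number below
  \<open>N\<close>.\<close>

lemma U_unbounded: "\<exists>x>0. y < U x"
proof -
  obtain N :: nat where N: "y < real N"
    using reals_Archimedean2 by blast
  have "((\<lambda>x::real. \<Sum>n<N. exp (- (2 ^ n * x))) \<longlongrightarrow> (\<Sum>n<N. exp (- (2 ^ n * 0)))) (at_right 0)"
    by (intro tendsto_intros)
  then have "eventually (\<lambda>x. y < (\<Sum>n<N. exp (- (2 ^ n * x)))) (at_right (0::real))"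
    using N by (intro order_tendstoD(1)) auto
  then have "eventually (\<lambda>x. y < (\<Sum>n<N. exp (- (2 ^ n * x))) \<and> 0 < x) (at_right (0::real))"
    by (intro eventually_conj eventually_at_right_less)
  then obtain x :: real where x: "0 < x" "y < (\<Sum>n<N. exp (- (2 ^ n * x)))"
    using eventually_happens'[OF trivial_limit_at_right_real] by blast
  note x(2)
  also have "(\<Sum>n<N. exp (- (2 ^ n * x))) \<le> (\<Sum>n<N. a n * exp (- (2 ^ n * x)))"
    using a_ge by (intro sum_mono) auto
  also have "\<dots> \<le> U x"
    unfolding U_eq[OF x(1)] using a_nonneg by (intro sum_le_suminf U_summable x(1)) auto
  finally show ?thesis using x(1) by blast
qed

text \<open>Injective by strict monotonicity, surjective by the intermediate value theorem between a
  point where \<open>U\<close> exceeds \<open>y\<close> and one where it is at most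
  \<open>y\<close>.\<close>

lemma bij_U: "bij_betw U {0<..} {0<..}"
  unfolding bij_betw_def
proof
  show "inj_on U {0<..}"
    by (rule inj_onI) (metis U_strict_antimono greaterThan_iff less_irrefl linorder_neqE)
  show "U ` {0<..} = {0<..}"
  proof (intro equalityI subsetI)
    fix y :: real assume "y \<in> {0<..}"
    then have y: "0 < y" by simp
    obtain x where x: "0 < x" "y < U x"
      using U_unbounded by blast
    \<comment> \<open>\<open>x + 1\<close> places \<open>z\<close> to the right of \<open>x\<close>
      and beyond 1, so that \<open>z ^ 3\<close> may be weakened to \<open>z\<close>;
      \<open>12 / y\<close> then gives \<open>12 / z \<le> y\<close>.\<close>
    define z where "z = max (x + 1) (12 / y)"
    have z: "x < z" "1 \<le> z" "12 / y \<le> z"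
      using x by (auto simp: z_def)
    have "U z \<le> 12 / z ^ 3"
      using z x by (intro U_le) auto
    also have "\<dots> \<le> 12 / z"
      using z by (intro divide_left_mono) (auto intro!: self_le_power)
    also have "\<dots> \<le> y"
      using z y by (simp add: field_simps)
    finally have "U z \<le> y" .
    moreover have "isCont U t" if "x \<le> t" for t
      using that x DERIV_isCont[OF U_has_derivative] by auto
    ultimately have "\<exists>t. x \<le> t \<and> t \<le> z \<and> U t = y"
      using x z by (intro IVT2) auto
    then obtain t where "x \<le> t" "U t = y"
      by blast
    then show "y \<in> U ` {0<..}"
      using x by force
  qed (auto simp: U_pos)
qed

lemma tail_conditions:
  "bij_betw U {0<..} {0<..} \<and>
    (\<forall>x>0. U differentiable (at x)) \<and> continuous_on {0<..} (deriv U) \<and>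
    (\<forall>x>0. deriv U x < 0) \<and>
    (INF x\<in>{0<..1}. \<bar>deriv U x\<bar>) > 0 \<and>
    bdd_above ((\<lambda>x. min 1 (x ^ 3) * \<bar>deriv U x\<bar>) ` {0<..})"
  using bij_U continuous_deriv_U deriv_U_neg Inf_deriv_U bounded_deriv_U U_has_derivative
  by (auto simp: real_differentiable_def intro!: exI)

end

subsection \<open>Moments, index and tails\<close>

lemma sets_dyadic_mixture [measurable_cong, simp]: "sets (dyadic_mixture a) = sets borel"
  by (simp add: dyadic_mixture_def)

lemma space_dyadic_mixture [simp]: "space (dyadic_mixture a) = UNIV"
  by (simp add: dyadic_mixture_def)

text \<open>No measurability of \<open>A\<close> has to be checked: non-measurable sets have
  \<open>emeasure\<close> 0 by convention.\<close>

lemma emeasure_eq_0_AE_notin: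
  assumes "AE z in M. z \<notin> A"
  shows "emeasure M A = 0"
proof (cases "A \<in> sets M")
  case True
  then have "{z \<in> space M. z \<in> A} = A"
    using sets.sets_into_space by blast
  with emeasure_eq_0_AE[OF assms] show ?thesis by simp
qed (rule emeasure_notin_sets)

lemma emeasure_dyadic_mixture:
  assumes [measurable]: "A \<in> sets borel"
  shows "emeasure (dyadic_mixture a) A =
    (\<Sum>n. ennreal (a n) * emeasure std_exp2 {z. z /\<^sub>R 2 ^ n \<in> A})"
proof -
  have "emeasure (dyadic_mixture a) A = (\<integral>\<^sup>+ z. indicator A z \<partial>dyadic_mixture a)"
    by simp
  also have "\<dots> = (\<Sum>n. ennreal (a n) * (\<integral>\<^sup>+ z. indicator A (z /\<^sub>R 2 ^ n) \<partial>std_exp2))"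
    by (rule nn_integral_dyadic_mixture) measurable
  also have "(\<lambda>n. \<integral>\<^sup>+ z. indicator A (z /\<^sub>R 2 ^ n) \<partial>std_exp2) =
      (\<lambda>n. emeasure std_exp2 {z. z /\<^sub>R 2 ^ n \<in> A})"
  proof
    fix n
    have [measurable]: "{z. z /\<^sub>R 2 ^ n \<in> A} \<in> sets borel" by measurable
    have "(\<integral>\<^sup>+ z. indicator A (z /\<^sub>R 2 ^ n) \<partial>std_exp2) =
        (\<integral>\<^sup>+ z. indicator {z. z /\<^sub>R 2 ^ n \<in> A} z \<partial>std_exp2)"
      by (intro nn_integral_cong) (auto simp: indicator_def)
    then show "(\<integral>\<^sup>+ z. indicator A (z /\<^sub>R 2 ^ n) \<partial>std_exp2) = emeasure std_exp2 {z. z /\<^sub>R 2 ^ n \<in> A}"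
      by simp
  qed
  finally show ?thesis .
qed

lemma emeasure_std_exp2_tail:
  assumes "0 \<le> x" "0 \<le> y"
  shows "emeasure std_exp2 ({x..} \<times> {y..}) = ennreal (exp (- x) * exp (- y))"
  using assms by (simp add: emeasure_std_exp2_Times emeasure_std_exp_atLeast ennreal_mult)

lemma AE_std_exp2_pos: "AE z in std_exp2. 0 < fst z \<and> 0 < snd z"
proof -
  \<comment> \<open>The law has a Lebesgue density, so the point 0 carries no mass.\<close>
  have "emeasure std_exp {0<..} = emeasure std_exp {0..}"
  proof (rule emeasure_eq_AE)
    show "AE x in std_exp. (x \<in> {0<..}) = (x \<in> {0..})"
      unfolding std_exp_def
      by (subst AE_density) (use AE_lborel_singleton[of 0] in \<open>auto elim!: eventually_mono\<close>)
  qed auto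
  then have "emeasure std_exp2 ({0<..} \<times> {0<..}) = 1"
    by (simp add: emeasure_std_exp2_Times emeasure_std_exp_atLeast)
  then have "std_exp2.prob ({0<..} \<times> {0<..}) = 1"
    by (simp add: measure_def)
  then have "AE z in std_exp2. z \<in> {0<..} \<times> {0<..}"
    by (subst std_exp2.AE_in_set_eq_1) (auto intro!: borel_open open_Times)
  then show ?thesis
    by eventually_elim auto
qed

text \<open>Positive scaling preserves the open quadrant, so its complement is null in every
  layer.\<close>

lemma AE_dyadic_mixture_pos: "AE z in dyadic_mixture a. 0 < fst z \<and> 0 < snd z"
proof -
  have null: "emeasure std_exp2 {z. z /\<^sub>R 2 ^ n \<in> {z. \<not> (0 < fst z \<and> 0 < snd z)}} = 0" for n
    by (rule emeasure_eq_0_AE_notin, use AE_std_exp2_pos in eventually_elim) simp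
  show ?thesis
  proof (rule AE_I)
    show "{z \<in> space (dyadic_mixture a). \<not> (0 < fst z \<and> 0 < snd z)} \<subseteq> {z. \<not> (0 < fst z \<and> 0 < snd z)}"
      by simp
    show "{z. \<not> (0 < fst z \<and> 0 < snd z)} \<in> sets (dyadic_mixture a)"
    proof -
      have "{z. \<not> (0 < fst z \<and> 0 < snd z)} = - ({0 :: real<..} \<times> {0 :: real<..})"
        by (auto simp: mem_Times_iff)
      also have "\<dots> \<in> sets borel"
        by (intro borel_comp borel_open open_Times) auto
      finally show ?thesis by simp
    qed
    then show "emeasure (dyadic_mixture a) {z. \<not> (0 < fst z \<and> 0 < snd z)} = 0"
      by (subst emeasure_dyadic_mixture) (simp_all only: null, simp_all)
  qed
qed

text \<open>Layer \<open>n\<close> moves the corner to \<open>2 ^ n\<close> times itself, and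
  independence multiplies the two exponential tails. The corners \<open>(x, 0)\<close> and
  \<open>(0, x)\<close> give one and the same series, hence equal tails \<open>U1\<close> and
  \<open>U2\<close>.\<close>

lemma dyadic_mixture_tail:
  assumes a: "\<And>n. 0 \<le> a n" and xy: "0 \<le> x" "0 \<le> y"
    and sm: "summable (\<lambda>n. a n * exp (- (2 ^ n * (x + y))))"
  shows "measure (dyadic_mixture a) ({x..} \<times> {y..}) = (\<Sum>n. a n * exp (- (2 ^ n * (x + y))))"
proof -
  have [measurable]: "{x..} \<times> {y..} \<in> sets borel"
    by (intro borel_closed closed_Times) auto
  have "{z. z /\<^sub>R 2 ^ n \<in> {x..} \<times> {y..}} = {2 ^ n * x..} \<times> {2 ^ n * y..}" for n
    by (auto simp: field_simps mem_Times_iff)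
  then have "emeasure (dyadic_mixture a) ({x..} \<times> {y..}) =
      (\<Sum>n. ennreal (a n * exp (- (2 ^ n * (x + y)))))"
    using a xy
    by (subst emeasure_dyadic_mixture)
      (auto simp: emeasure_std_exp2_tail ennreal_mult[symmetric] exp_add[symmetric] algebra_simps)
  also have "\<dots> = ennreal (\<Sum>n. a n * exp (- (2 ^ n * (x + y))))"
    using a sm by (intro suminf_ennreal2) auto
  finally show ?thesis
    using a sm by (simp add: measure_def suminf_nonneg)
qed

lemma norm_scaled_powr: "norm (z /\<^sub>R 2 ^ n) powr p = (2 ^ n) powr - p * norm z powr p"
  by (simp add: powr_mult powr_minus inverse_powr powr_divide divide_inverse mult.commute)

text \<open>Homogeneity of the norm pulls the scale out of each layer. The identity holds with
  infinite values allowed.\<close>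

lemma dyadic_mixture_moment:
  assumes "\<And>n. 0 \<le> a n"
  shows "(\<integral>\<^sup>+ z. ennreal (norm z powr p) \<partial>dyadic_mixture a) =
    (\<Sum>n. ennreal (a n * (2 ^ n) powr - p)) * (\<integral>\<^sup>+ z. ennreal (norm z powr p) \<partial>std_exp2)"
proof -
  have "(\<integral>\<^sup>+ z. ennreal (norm z powr p) \<partial>dyadic_mixture a) =
      (\<Sum>n. ennreal (a n) * (\<integral>\<^sup>+ z. ennreal (norm (z /\<^sub>R 2 ^ n) powr p) \<partial>std_exp2))"
    by (rule nn_integral_dyadic_mixture) measurable
  also have "\<dots> = (\<Sum>n. ennreal (a n * (2 ^ n) powr - p) * (\<integral>\<^sup>+ z. ennreal (norm z powr p) \<partial>std_exp2))"
    unfolding norm_scaled_powr by (simp add: ennreal_mult assms nn_integral_cmult mult.assoc)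
  finally show ?thesis
    by simp
qed

lemma dyadic_mixture_moment_finite:
  assumes "\<And>n. 0 \<le> a n" "0 \<le> p" "summable (\<lambda>n. a n * (2 ^ n) powr - p)"
  shows "(\<integral>\<^sup>+ z. ennreal (norm z powr p) \<partial>dyadic_mixture a) < \<infinity>"
  using assms std_exp2_moment_finite[of p]
  by (simp add: dyadic_mixture_moment suminf_ennreal2 ennreal_mult_less_top)

text \<open>Otherwise the square of side 1/2 at the origin would be null, although the exponential
  law charges it.\<close>

lemma std_exp2_truncated_moment_pos:
  assumes "0 \<le> p"
  shows "(\<integral>\<^sup>+ z \<in> {z. norm z \<le> 1}. ennreal (norm z powr p) \<partial>std_exp2) > 0"
proof (rule ccontr)
  assume "\<not> ?thesis"
  then have "(\<integral>\<^sup>+ z \<in> {z. norm z \<le> 1}. ennreal (norm z powr p) \<partial>std_exp2) = 0"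
    by simp
  then have "AE z in std_exp2. ennreal (norm z powr p) * indicator {z. norm z \<le> 1} z = 0"
    by (subst (asm) nn_integral_0_iff_AE) auto
  \<comment> \<open>The square lies in the unit ball. Positive coordinates exclude the origin, where
    \<open>0 powr p = 0\<close>.\<close>
  with AE_std_exp2_pos have "AE z in std_exp2. z \<notin> {0..1/2} \<times> {0..1/2}"
  proof eventually_elim
    case (elim z)
    show ?case
    proof
      assume "z \<in> {0..1/2} \<times> {0..1/2}"
      then have "norm z \<le> 1"
        using norm_Pair_le[of "fst z" "snd z"] by (auto simp: mem_Times_iff)
      moreover have "z \<noteq> 0" using elim by auto
      ultimately show False using elim by (auto simp: indicator_def split: if_splits)
    qed
  qed
  then have "emeasure std_exp2 ({0..1/2} \<times> {0..1/2}) = 0"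
    by (rule emeasure_eq_0_AE_notin)
  then have "emeasure std_exp {0..1/2} = 0"
    by (simp add: emeasure_std_exp2_Times)
  moreover have "emeasure std_exp {0..} \<le> emeasure std_exp ({0..1/2} \<union> {1/2..})"
    by (intro emeasure_mono) auto
  moreover have "emeasure std_exp ({0..1/2} \<union> {1/2..}) \<le> emeasure std_exp {0..1/2} + emeasure std_exp {1/2..}"
    by (intro emeasure_subadditive) auto
  \<comment> \<open>If \<open>{0..1/2}\<close> is null, the tails from 0 and from 1/2 agree, that
    is, \<open>1 \<le> exp (- (1 / 2))\<close>.\<close>
  ultimately have "emeasure std_exp {0..} \<le> emeasure std_exp {1/2..}"
    by (metis add_0 order_trans)
  then have "ennreal 1 \<le> ennreal (exp (- (1 / 2)))"
    by (simp add: emeasure_std_exp_atLeast)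
  then show False
    by (subst (asm) ennreal_le_iff) auto
qed

text \<open>Division by \<open>2 ^ n\<close> maps the unit ball into itself, so layer
  \<open>n\<close> contributes at least its weight times \<open>(2 ^ n) powr - p\<close> times the
  truncated moment of \<open>std_exp2\<close>. As that moment is positive, the weighted series must
  be finite.\<close>

lemma dyadic_mixture_truncated_moment_finiteD:
  assumes a: "\<And>n. 0 \<le> a n" and p: "0 \<le> p"
    and fin: "(\<integral>\<^sup>+ z \<in> {z. norm z \<le> 1}. ennreal (norm z powr p) \<partial>dyadic_mixture a) < \<infinity>"
  shows "summable (\<lambda>n. a n * (2 ^ n) powr - p)"
proof -
  let ?K = "\<integral>\<^sup>+ z \<in> {z. norm z \<le> 1}. ennreal (norm z powr p) \<partial>std_exp2"
  have [measurable]: "{z :: real \<times> real. norm z \<le> 1} \<in> sets borel" by measurable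
  have "(\<Sum>n. ennreal (a n * (2 ^ n) powr - p)) * ?K =
      (\<Sum>n. ennreal (a n) * (\<integral>\<^sup>+ z. ennreal ((2 ^ n) powr - p) *
        (ennreal (norm z powr p) * indicator {z. norm z \<le> 1} z) \<partial>std_exp2))"
    by (simp add: ennreal_mult a nn_integral_cmult mult.assoc flip: ennreal_suminf_multc)
  also have "\<dots> \<le> (\<Sum>n. ennreal (a n) * (\<integral>\<^sup>+ z. ennreal (norm (z /\<^sub>R 2 ^ n) powr p) *
        indicator {z. norm z \<le> 1} (z /\<^sub>R 2 ^ n) \<partial>std_exp2))"
  proof (intro suminf_le mult_left_mono nn_integral_mono)
    fix n and z :: "real \<times> real"
    have "norm (z /\<^sub>R 2 ^ n) \<le> norm z"
      by (simp add: divide_le_eq_1 divide_inverse[symmetric] mult_left_le_one_le inverse_le_1_iff)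
    then show "ennreal ((2 ^ n) powr - p) * (ennreal (norm z powr p) * indicator {z. norm z \<le> 1} z)
        \<le> ennreal (norm (z /\<^sub>R 2 ^ n) powr p) * indicator {z. norm z \<le> 1} (z /\<^sub>R 2 ^ n)"
      unfolding norm_scaled_powr by (auto simp: indicator_def ennreal_mult)
  qed auto
  also have "\<dots> = (\<integral>\<^sup>+ z \<in> {z. norm z \<le> 1}. ennreal (norm z powr p) \<partial>dyadic_mixture a)"
    by (rule nn_integral_dyadic_mixture[symmetric]) measurable
  finally have "(\<Sum>n. ennreal (a n * (2 ^ n) powr - p)) * ?K < \<infinity>"
    using fin by (rule order.strict_trans1)
  then have "(\<Sum>n. ennreal (a n * (2 ^ n) powr - p)) \<noteq> \<top>"
    using std_exp2_truncated_moment_pos[OF p] by (auto simp: ennreal_mult_less_top)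
  then show ?thesis
    using a by (intro summable_suminf_not_top) auto
qed

section \<open>Weights with a prescribed critical exponent\<close>

definition bg_weight :: "real \<Rightarrow> nat \<Rightarrow> real" where
  "bg_weight \<beta> n = (2 ^ n / (real n + 1)) powr \<beta>"

lemma Suc_le_two_power: "real n + 1 \<le> 2 ^ n"
  using Bernoulli_inequality[of "1 :: real" n] by simp

lemma bg_weight_ge_1:
  assumes "0 \<le> \<beta>"
  shows "1 \<le> bg_weight \<beta> n"
  unfolding bg_weight_def by (intro ge_one_powr_ge_zero assms) (use Suc_le_two_power in auto)

lemma bg_weight_nonneg: "0 \<le> bg_weight \<beta> n"
  by (simp add: bg_weight_def)

text \<open>The base is at least 1, so the exponent may be raised to 2. The remaining inverse square
  gives summability even at \<open>\<beta> = 2\<close>.\<close>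

lemma bg_weight_le_square:
  assumes "\<beta> \<le> 2"
  shows "bg_weight \<beta> n \<le> 4 ^ n * (1 / (real n + 1)\<^sup>2)"
proof -
  have "bg_weight \<beta> n \<le> (2 ^ n / (real n + 1)) powr 2"
    unfolding bg_weight_def by (intro powr_mono assms) (use Suc_le_two_power in auto)
  also have "\<dots> = 4 ^ n * (1 / (real n + 1)\<^sup>2)"
    by (simp add: powr_numeral power_divide power_mult[symmetric] mult.commute[of n])
      (simp add: power_mult)
  finally show ?thesis .
qed

lemma bg_weight_le:
  assumes "\<beta> \<le> 2"
  shows "bg_weight \<beta> n \<le> 4 ^ n"
proof -
  note bg_weight_le_square[OF assms]
  also have "4 ^ n * (1 / (real n + 1)\<^sup>2) \<le> 4 ^ n * 1"
    by (intro mult_left_mono) (auto simp: divide_le_eq_1 one_le_power)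
  finally show ?thesis by simp
qed

lemma bg_weight_summable:
  assumes "\<beta> \<le> 2"
  shows "summable (\<lambda>n. bg_weight \<beta> n / 4 ^ n)"
proof (rule summable_comparison_test')
  show "summable (\<lambda>n. 1 / (real n + 1)\<^sup>2)"
    using summable_Suc_iff[of "\<lambda>n. inverse ((real n)\<^sup>2)"] inverse_power_summable[of 2, where 'a=real]
    by (simp add: divide_inverse add.commute)
  show "norm (bg_weight \<beta> n / 4 ^ n) \<le> 1 / (real n + 1)\<^sup>2" for n
    using bg_weight_le_square[OF assms, of n] bg_weight_nonneg[of \<beta> n]
    by (simp add: divide_le_eq mult.commute)
qed

text \<open>Dropping the denominator \<open>n + 1\<close> leaves a geometric series of ratio
  \<open>2 powr (\<beta> - p)\<close>, which is below 1.\<close>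

lemma bg_weight_summable_powr:
  assumes "0 \<le> \<beta>" "\<beta> < p"
  shows "summable (\<lambda>n. bg_weight \<beta> n * (2 ^ n) powr - p)"
proof (rule summable_comparison_test')
  show "summable (\<lambda>n. (2 powr (\<beta> - p)) ^ n)"
    using assms powr_less_mono[of "\<beta> - p" 0 2] by (intro summable_geometric) auto
  show "norm (bg_weight \<beta> n * (2 ^ n) powr - p) \<le> (2 powr (\<beta> - p)) ^ n" for n
  proof -
    have "bg_weight \<beta> n \<le> (2 ^ n) powr \<beta>"
      unfolding bg_weight_def using assms by (intro powr_mono2) (auto simp: divide_le_eq)
    then have "bg_weight \<beta> n * (2 ^ n) powr - p \<le> (2 ^ n) powr \<beta> * (2 ^ n) powr - p"
      by (intro mult_right_mono) auto
    also have "\<dots> = (2 powr (\<beta> - p)) ^ n"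
      by (simp add: powr_add[symmetric] powr_powr powr_realpow[symmetric] algebra_simps)
    finally show ?thesis by (simp add: bg_weight_nonneg)
  qed
qed

text \<open>Exponential growth at rate \<open>\<beta> - p\<close> beats the polynomial factor, so
  the terms tend to infinity.\<close>

lemma bg_weight_not_summable_powr:
  assumes "p < \<beta>"
  shows "\<not> summable (\<lambda>n. bg_weight \<beta> n * (2 ^ n) powr - p)"
proof
  assume "summable (\<lambda>n. bg_weight \<beta> n * (2 ^ n) powr - p)"
  then have "(\<lambda>n. bg_weight \<beta> n * (2 ^ n) powr - p) \<longlonglongrightarrow> 0"
    by (rule summable_LIMSEQ_zero)
  moreover have "filterlim (\<lambda>n. bg_weight \<beta> n * (2 ^ n) powr - p) at_top sequentially"
  proof -
    \<comment> \<open>Writing \<open>p\<close> through \<open>d > 0\<close> shows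
      \<open>real_asymp\<close> the sign of the exponential rate.\<close>
    define d where "d = \<beta> - p"
    have d: "d > 0" "p = \<beta> - d" using assms by (auto simp: d_def)
    show ?thesis
      using d(1) unfolding bg_weight_def d(2) by real_asymp
  qed
  ultimately show False
    using not_tendsto_and_filterlim_at_infinity[OF sequentially_bot _ filterlim_at_top_imp_at_infinity]
    by blast
qed

section \<open>The constructed measure: integrability, index and tails\<close>

definition bg_measure :: "real \<Rightarrow> (real \<times> real) measure" where
  "bg_measure \<beta> = dyadic_mixture (bg_weight \<beta>)"

lemma levy_measure_bg_measure:
  assumes "\<beta> \<le> 2"
  shows "levy_measure (bg_measure \<beta>)"
  unfolding levy_measure_def
proof (intro conjI)
  show "sets (bg_measure \<beta>) = sets borel"
    by (simp add: bg_measure_def)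
  show "emeasure (bg_measure \<beta>) {0} = 0"
    unfolding bg_measure_def
    by (rule emeasure_eq_0_AE_notin, use AE_dyadic_mixture_pos in eventually_elim) auto
  have "(\<integral>\<^sup>+ x. ennreal (min ((norm x)\<^sup>2) 1) \<partial>bg_measure \<beta>) \<le>
      (\<integral>\<^sup>+ x. ennreal (norm x powr 2) \<partial>bg_measure \<beta>)"
    by (intro nn_integral_mono) (auto simp: powr_numeral)
  also have "\<dots> < \<infinity>"
    unfolding bg_measure_def
  proof (rule dyadic_mixture_moment_finite)
    \<comment> \<open>The summability lemma for \<open>p > \<beta>\<close> would miss
      \<open>\<beta> = 2\<close>; here the inverse-square factor of the weights is used.\<close>
    have "(2 ^ n) powr - 2 = 1 / (4::real) ^ n" for n
      by (simp add: powr_minus powr_numeral divide_inverse power_mult[symmetric] mult.commute[of n])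
        (simp add: power_mult)
    then show "summable (\<lambda>n. bg_weight \<beta> n * (2 ^ n) powr - 2)"
      using bg_weight_summable[OF assms] by simp
  qed (auto simp: bg_weight_nonneg)
  finally show "(\<integral>\<^sup>+ x. ennreal (min ((norm x)\<^sup>2) 1) \<partial>bg_measure \<beta>) < \<infinity>" .
qed

text \<open>The moment is over the whole plane: the exponential law has all moments, so only the
  weights restrict \<open>p\<close>. It serves both the index and the moment of order above
  8.\<close>

lemma bg_measure_moment_finite:
  assumes "0 \<le> \<beta>" "\<beta> < p"
  shows "(\<integral>\<^sup>+ x. ennreal (norm x powr p) \<partial>bg_measure \<beta>) < \<infinity>"
  unfolding bg_measure_def using assms
  by (intro dyadic_mixture_moment_finite bg_weight_summable_powr bg_weight_nonneg) auto

text \<open>Every \<open>p > \<beta>\<close> belongs to the set and no \<open>p < \<beta>\<close>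
  does; membership of \<open>\<beta>\<close> itself is left open.\<close>

lemma index_bg_measure:
  assumes "0 \<le> \<beta>"
  shows "blumenthal_getoor_index (bg_measure \<beta>) = \<beta>"
  unfolding blumenthal_getoor_index_def
proof (rule cInf_eq_non_empty)
  have mem: "p \<in> {p. 0 \<le> p \<and> (\<integral>\<^sup>+ x \<in> {x. norm x \<le> 1}. ennreal (norm x powr p) \<partial>bg_measure \<beta>) < \<infinity>}"
    if p: "\<beta> < p" for p
  proof -
    have "(\<integral>\<^sup>+ x \<in> {x. norm x \<le> 1}. ennreal (norm x powr p) \<partial>bg_measure \<beta>) \<le>
        (\<integral>\<^sup>+ x. ennreal (norm x powr p) \<partial>bg_measure \<beta>)"
      by (intro nn_integral_mono) (auto simp: indicator_def)
    also note bg_measure_moment_finite[OF assms p]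
    finally show ?thesis using assms p by simp
  qed
  show "{p. 0 \<le> p \<and> (\<integral>\<^sup>+ x \<in> {x. norm x \<le> 1}. ennreal (norm x powr p) \<partial>bg_measure \<beta>) < \<infinity>} \<noteq> {}"
    using mem[of "\<beta> + 1"] by auto
  show "\<beta> \<le> p" if "p \<in> {p. 0 \<le> p \<and> (\<integral>\<^sup>+ x \<in> {x. norm x \<le> 1}. ennreal (norm x powr p) \<partial>bg_measure \<beta>) < \<infinity>}" for p
  proof (rule ccontr)
    assume "\<not> \<beta> \<le> p"
    with that bg_weight_not_summable_powr[of p \<beta>] show False
      using dyadic_mixture_truncated_moment_finiteD[of "bg_weight \<beta>" p] bg_weight_nonneg
      by (auto simp: bg_measure_def)
  qed
  \<comment> \<open>A lower bound of the set lies below every \<open>p > \<beta>\<close>, hence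
    below \<open>\<beta>\<close> by density of the reals.\<close>
  show "y \<le> \<beta>" if "\<And>p. p \<in> {p. 0 \<le> p \<and> (\<integral>\<^sup>+ x \<in> {x. norm x \<le> 1}. ennreal (norm x powr p) \<partial>bg_measure \<beta>) < \<infinity>} \<Longrightarrow> y \<le> p" for y
    using that[OF mem] by (rule dense_ge)
qed

lemma bg_measure_quadrant: "emeasure (bg_measure \<beta>) (UNIV - {0..} \<times> {0..}) = 0"
  unfolding bg_measure_def
  by (rule emeasure_eq_0_AE_notin, use AE_dyadic_mixture_pos in eventually_elim)
    (auto simp: mem_Times_iff)

lemma dyadic_tail_bg_measure:
  assumes \<beta>: "0 \<le> \<beta>" "\<beta> \<le> 2" and U: "U \<in> {U1 (bg_measure \<beta>), U2 (bg_measure \<beta>)}"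
  shows "dyadic_tail (bg_weight \<beta>) U"
proof
  fix x :: real assume x: "0 < x"
  have sm: "summable (\<lambda>n. bg_weight \<beta> n * exp (- (2 ^ n * x)))"
    by (rule summable_dyadic_exp_series[OF x, where k=2])
      (use bg_weight_le[OF \<beta>(2)] in \<open>auto simp: bg_weight_nonneg power_mult\<close>)
  show "U x = (\<Sum>n. bg_weight \<beta> n * exp (- (2 ^ n * x)))"
    using U x sm dyadic_mixture_tail[of "bg_weight \<beta>" x 0] dyadic_mixture_tail[of "bg_weight \<beta>" 0 x]
    by (auto simp: U1_def U2_def bg_measure_def bg_weight_nonneg)
qed (use \<beta> in \<open>auto intro: bg_weight_ge_1 bg_weight_summable bg_weight_le\<close>)

subsection \<open>Fourier decay\<close>

text \<open>Both 1 and \<open>\<bar>u\<bar>\<close> are absolute values of the real and imaginary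
  part. This turns division by the complex rate into decay in
  \<open>1 + \<bar>u\<bar>\<close>.\<close>

lemma abs_le_norm_Complex_minus_1:
  fixes u :: real
  shows "1 + \<bar>u\<bar> \<le> 2 * cmod (Complex (-1) u)"
proof -
  have "1 \<le> cmod (Complex (-1) u)" "\<bar>u\<bar> \<le> cmod (Complex (-1) u)"
    using abs_Re_le_cmod[of "Complex (-1) u"] abs_Im_le_cmod[of "Complex (-1) u"] by auto
  then show ?thesis by simp
qed

lemma borel_measurable_cis [measurable]: "cis \<in> borel_measurable borel"
  by (intro borel_measurable_continuous_onI continuous_intros)

lemma integrable_std_exp_power: "integrable std_exp (\<lambda>x. x ^ k)"
proof (rule integrableI_bounded)
  have "(\<integral>\<^sup>+ x. ennreal (norm (x ^ k)) \<partial>std_exp) =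
      (\<integral>\<^sup>+ x. ennreal (x ^ k * exp (- x)) * indicator {0..} x \<partial>lborel)"
    by (subst nn_integral_std_exp)
      (auto intro!: nn_integral_cong simp: indicator_def ennreal_mult[symmetric] mult.commute)
  then show "(\<integral>\<^sup>+ x. ennreal (norm (x ^ k)) \<partial>std_exp) < \<infinity>"
    by (simp add: nn_intergal_power_times_exp_Ici)
qed simp

lemma integral_std_exp_power: "(\<integral> x. x ^ k \<partial>std_exp) = fact k"
proof -
  have "(\<integral>\<^sup>+ x. ennreal (x ^ k) \<partial>std_exp) =
      (\<integral>\<^sup>+ x. ennreal (x ^ k * exp (- x)) * indicator {0..} x \<partial>lborel)"
    by (subst nn_integral_std_exp)
      (auto intro!: nn_integral_cong simp: indicator_def ennreal_mult[symmetric] mult.commute)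
  then have "(\<integral>\<^sup>+ x. ennreal (x ^ k) \<partial>std_exp) = ennreal (fact k)"
    by (simp add: nn_intergal_power_times_exp_Ici)
  moreover have "AE x in std_exp. 0 \<le> x ^ k"
    unfolding std_exp_def by (subst AE_density) (auto simp: exponential_density_def)
  ultimately show ?thesis
    by (intro integral_eq_nn_integral[THEN trans]) auto
qed

text \<open>The Fourier transform of \<open>x ^ k\<close> times the exponential law, classically
  \<open>k! / (1 - i u) ^ (k + 1)\<close>.\<close>

definition exp_transform :: "nat \<Rightarrow> real \<Rightarrow> complex" where
  "exp_transform k u = (\<integral> x. x ^ k *\<^sub>R cis (u * x) \<partial>std_exp)"

lemma integrable_exp_transform: "integrable std_exp (\<lambda>x. x ^ k *\<^sub>R cis (u * x))"
  by (rule Bochner_Integration.integrable_bound[OF integrable_std_exp_power[of k]]) auto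

text \<open>Density and character merge into one exponential with complex rate
  \<open>-1 + i u\<close>. The null endpoint 0 is removed to obtain the open interval required by
  the fundamental theorem of calculus.\<close>

lemma exp_transform_alt:
  "set_integrable lborel {0<..} (\<lambda>x. x ^ k *\<^sub>R exp (x *\<^sub>R Complex (-1) u))"
  "exp_transform k u = (LBINT x:{0<..}. x ^ k *\<^sub>R exp (x *\<^sub>R Complex (-1) u))"
proof -
  have eq: "exponential_density 1 x *\<^sub>R x ^ k *\<^sub>R cis (u * x) =
      indicator {0..} x *\<^sub>R x ^ k *\<^sub>R exp (x *\<^sub>R Complex (-1) u)" for x
    by (auto simp: exponential_density_def exp_eq_polar indicator_def scaleR_conv_of_real
        complex_eq_iff mult.commute cis.ctr Complex_eq exp_add)
  have ae: "AE x in lborel. indicator {0..} x *\<^sub>R x ^ k *\<^sub>R exp (x *\<^sub>R Complex (-1) u) =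
      indicator {0<..} x *\<^sub>R x ^ k *\<^sub>R exp (x *\<^sub>R Complex (-1) u)"
    using AE_lborel_singleton[of "0 :: real"] by eventually_elim (auto simp: indicator_def)
  have m [measurable]: "(\<lambda>x. x ^ k *\<^sub>R cis (u * x)) \<in> borel_measurable borel"
      "(\<lambda>x. x ^ k *\<^sub>R exp (x *\<^sub>R Complex (-1) u)) \<in> borel_measurable borel"
    by (auto intro!: borel_measurable_continuous_onI continuous_intros)
  have "integrable lborel (\<lambda>x. exponential_density 1 x *\<^sub>R x ^ k *\<^sub>R cis (u * x))"
    using integrable_exp_transform[of k u] unfolding std_exp_def
    by (subst (asm) integrable_density) (auto simp: exponential_density_nonneg)
  then show "set_integrable lborel {0<..} (\<lambda>x. x ^ k *\<^sub>R exp (x *\<^sub>R Complex (-1) u))"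
    unfolding set_integrable_def eq
    by (subst integrable_cong_AE[OF _ _ ae, symmetric]) auto
  have "exp_transform k u = (\<integral> x. exponential_density 1 x *\<^sub>R x ^ k *\<^sub>R cis (u * x) \<partial>lborel)"
    unfolding exp_transform_def std_exp_def
    by (subst integral_density) (auto simp: exponential_density_nonneg)
  also have "\<dots> = (LBINT x:{0<..}. x ^ k *\<^sub>R exp (x *\<^sub>R Complex (-1) u))"
    unfolding eq set_lebesgue_integral_def by (rule integral_cong_AE[OF _ _ ae]) auto
  finally show "exp_transform k u = (LBINT x:{0<..}. x ^ k *\<^sub>R exp (x *\<^sub>R Complex (-1) u))" .
qed

lemma einterval_0_infinity: "einterval 0 \<infinity> = {0<..}"
  by (auto simp: einterval_def zero_ereal_def)

text \<open>Integration by parts; for \<open>k = 0\<close> the factor \<open>of_nat k\<close> kills the junk index \<open>k - 1\<close>.\<close>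

lemma exp_transform_recurrence:
  "Complex (-1) u * exp_transform k u = - (of_nat k * exp_transform (k - 1) u) - 0 ^ k"
proof -
  define z where "z = Complex (-1) u"
  let ?g = "\<lambda>k x. x ^ k *\<^sub>R exp (x *\<^sub>R z)"
  note alt = exp_transform_alt[where u=u, folded z_def]
  \<comment> \<open>The antiderivative \<open>?g k\<close> vanishes at infinity and has the limit
    \<open>0 ^ k\<close> at 0, which is 1 for \<open>k = 0\<close> and 0 otherwise.\<close>
  have "(LBINT x=0..\<infinity>. of_nat k * ?g (k - 1) x + z * ?g k x) = 0 - 0 ^ k"
  proof (rule interval_integral_FTC_integrable)
    show "(?g k has_vector_derivative of_nat k * ?g (k - 1) x + z * ?g k x) (at x)" for x
    proof -
      have "((\<lambda>x. x ^ k) has_field_derivative of_nat k * x ^ (k - 1)) (at x)"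
        by (auto intro!: derivative_eq_intros)
      from has_vector_derivative_scaleR[OF this exp_scaleR_has_vector_derivative_right]
      show ?thesis
        by (rule has_vector_derivative_eq_rhs) (simp add: scaleR_conv_of_real algebra_simps)
    qed
    show "isCont (\<lambda>x. of_nat k * ?g (k - 1) x + z * ?g k x) x" for x
      by (intro continuous_intros)
    show "set_integrable lborel (einterval 0 \<infinity>) (\<lambda>x. of_nat k * ?g (k - 1) x + z * ?g k x)"
      unfolding einterval_0_infinity
      by (intro set_integral_add set_integrable_mult_right alt)
    have "(?g k \<longlongrightarrow> 0 ^ k *\<^sub>R exp (0 *\<^sub>R z)) (at_right 0)"
      by (intro tendsto_intros)
    then show "((?g k \<circ> real_of_ereal) \<longlongrightarrow> 0 ^ k) (at_right 0)"
      by (simp add: zero_ereal_def ereal_tendsto_simps scaleR_conv_of_real)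
    have "(?g k \<longlongrightarrow> 0) at_top"
    proof (rule tendsto_norm_zero_cancel)
      have "((\<lambda>x :: real. \<bar>x ^ k / exp x\<bar>) \<longlongrightarrow> 0) at_top"
        by (rule tendsto_rabs_zero[OF tendsto_power_div_exp_0])
      then show "((\<lambda>x. norm (?g k x)) \<longlongrightarrow> 0) at_top"
        by (simp add: z_def norm_exp_eq_Re exp_minus divide_inverse abs_mult)
    qed
    then show "((?g k \<circ> real_of_ereal) \<longlongrightarrow> 0) (at_left \<infinity>)"
      by (simp add: ereal_tendsto_simps)
  qed auto
  also have "(LBINT x=0..\<infinity>. of_nat k * ?g (k - 1) x + z * ?g k x) =
      of_nat k * exp_transform (k - 1) u + z * exp_transform k u"
    unfolding interval_lebesgue_integral_def einterval_0_infinity alt(2)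
    by (simp only: set_integral_add set_integrable_mult_right alt(1) set_integral_mult_right) simp
  finally show ?thesis
    unfolding z_def by (simp add: algebra_simps eq_neg_iff_add_eq_0)
qed

lemma norm_exp_transform_le_fact: "cmod (exp_transform k u) \<le> fact k"
proof -
  have "cmod (exp_transform k u) \<le> (\<integral> x. norm (x ^ k *\<^sub>R cis (u * x)) \<partial>std_exp)"
    unfolding exp_transform_def by (rule integral_norm_bound)
  also have "\<dots> = (\<integral> x. x ^ k \<partial>std_exp)"
  proof (rule integral_cong_AE)
    show "AE x in std_exp. norm (x ^ k *\<^sub>R cis (u * x)) = x ^ k"
      unfolding std_exp_def by (subst AE_density) (auto simp: exponential_density_def)
  qed measurable
  finally show ?thesis by (simp add: integral_std_exp_power)
qed

text \<open>One use of the recurrence, followed by the trivial factorial bound on the lower index,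
  gives \<open>k!\<close> for the product with the complex rate. For \<open>k = 0\<close> the
  boundary term alone gives 1.\<close>

lemma norm_exp_transform_le: "cmod (exp_transform k u) \<le> 2 * fact k / (1 + \<bar>u\<bar>)"
proof -
  have "cmod (Complex (-1) u * exp_transform k u) \<le> fact k"
  proof (cases k)
    case 0
    then show ?thesis by (subst exp_transform_recurrence) simp
  next
    case (Suc j)
    then have "cmod (Complex (-1) u * exp_transform k u) = real k * cmod (exp_transform j u)"
      by (subst exp_transform_recurrence) (simp add: norm_mult del: of_nat_Suc)
    also have "\<dots> \<le> real k * fact j"
      by (intro mult_left_mono norm_exp_transform_le_fact) auto
    finally show ?thesis using Suc by simp
  qed
  moreover have "(1 + \<bar>u\<bar>) * cmod (exp_transform k u) \<le>
      2 * cmod (Complex (-1) u) * cmod (exp_transform k u)"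
    by (intro mult_right_mono abs_le_norm_Complex_minus_1) auto
  ultimately have "(1 + \<bar>u\<bar>) * cmod (exp_transform k u) \<le> 2 * fact k"
    by (simp add: norm_mult)
  then show ?thesis by (simp add: field_simps)
qed

text \<open>The character of a sum is a product, so Fubini factors the transform over the
  independent coordinates.\<close>

lemma std_exp2_product_transform:
  shows "integrable std_exp2 (\<lambda>z. (fst z ^ j * snd z ^ k) *\<^sub>R cis (u * fst z + v * snd z))"
    and "(\<integral> z. (fst z ^ j * snd z ^ k) *\<^sub>R cis (u * fst z + v * snd z) \<partial>std_exp2) =
      exp_transform j u * exp_transform k v"
proof -
  let ?f = "\<lambda>z. (fst z ^ j * snd z ^ k) *\<^sub>R cis (u * fst z + v * snd z)"
  have eq: "?f (x, y) = (x ^ j *\<^sub>R cis (u * x)) * (y ^ k *\<^sub>R cis (v * y))" for x y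
    by (simp add: cis_mult)
  have [measurable]: "?f \<in> borel_measurable (std_exp \<Otimes>\<^sub>M std_exp)"
    by measurable
  have int: "integrable (std_exp \<Otimes>\<^sub>M std_exp) ?f"
  proof (rule std_exp_pair.Fubini_integrable)
    show "integrable std_exp (\<lambda>x. \<integral> y. norm (?f (x, y)) \<partial>std_exp)"
      unfolding eq norm_mult
      by (simp add: integrable_norm[OF integrable_exp_transform] del: norm_scaleR)
    show "AE x in std_exp. integrable std_exp (\<lambda>y. ?f (x, y))"
      unfolding eq by (intro AE_I2 integrable_mult_right integrable_exp_transform)
  qed measurable
  then show "integrable std_exp2 ?f" by (simp add: std_exp2_def)
  have "integral\<^sup>L std_exp2 ?f = (\<integral> x. (\<integral> y. ?f (x, y) \<partial>std_exp) \<partial>std_exp)"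
    unfolding std_exp2_def by (rule std_exp_pair.integral_fst'[OF int, symmetric])
  also have "\<dots> = exp_transform j u * exp_transform k v"
    unfolding eq exp_transform_def by (simp only: integral_mult_right_zero integral_mult_left_zero)
  finally show "integral\<^sup>L std_exp2 ?f = exp_transform j u * exp_transform k v" .
qed

lemma norm_std_exp2_transform_le:
  "cmod (\<integral> z. (fst z ^ 4 + snd z ^ 4) *\<^sub>R cis (u * fst z + v * snd z) \<partial>std_exp2)
    \<le> 192 / ((1 + \<bar>u\<bar>) * (1 + \<bar>v\<bar>))"
proof -
  have *: "cmod (exp_transform j u * exp_transform k v) \<le> 4 * fact j * fact k / ((1 + \<bar>u\<bar>) * (1 + \<bar>v\<bar>))" for j k
    unfolding norm_mult
    by (rule order_trans[OF mult_mono[OF norm_exp_transform_le norm_exp_transform_le]]) auto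
  \<comment> \<open>Each fourth power is read as a product with a zeroth power; the two products are
    bounded by \<open>4 * 4! = 96\<close> each, which gives 192.\<close>
  have "(\<integral> z. (fst z ^ 4 + snd z ^ 4) *\<^sub>R cis (u * fst z + v * snd z) \<partial>std_exp2) =
      (\<integral> z. (fst z ^ 4 * snd z ^ 0) *\<^sub>R cis (u * fst z + v * snd z) +
        (fst z ^ 0 * snd z ^ 4) *\<^sub>R cis (u * fst z + v * snd z) \<partial>std_exp2)"
    by (simp add: scaleR_add_left)
  also have "\<dots> = exp_transform 4 u * exp_transform 0 v + exp_transform 0 u * exp_transform 4 v"
    unfolding Bochner_Integration.integral_add[OF std_exp2_product_transform(1) std_exp2_product_transform(1)]
    unfolding std_exp2_product_transform(2) ..
  finally have "cmod (\<integral> z. (fst z ^ 4 + snd z ^ 4) *\<^sub>R cis (u * fst z + v * snd z) \<partial>std_exp2) \<le>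
      cmod (exp_transform 4 u * exp_transform 0 v) + cmod (exp_transform 0 u * exp_transform 4 v)"
    by (simp only: norm_triangle_ineq)
  then show ?thesis
    using *[of 4 0] *[of 0 4] by (simp add: fact_numeral)
qed

text \<open>Fubini against counting measure and the triangle inequality. Integrability of
  \<open>F\<close> need not be assumed: without it the Bochner integral is 0 and the bound is
  trivial.\<close>

lemma norm_integral_count_pair_le:
  fixes F :: "nat \<times> (real \<times> real) \<Rightarrow> complex"
  assumes bound: "\<And>n. cmod (\<integral> z. F (n, z) \<partial>std_exp2) \<le> B n" and B: "summable B"
  shows "cmod (integral\<^sup>L (count_space UNIV \<Otimes>\<^sub>M std_exp2) F) \<le> (\<Sum>n. B n)"
proof -
  have B0: "0 \<le> B n" for n
    using bound[of n] norm_ge_zero order_trans by blast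
  show ?thesis
  proof (cases "integrable (count_space UNIV \<Otimes>\<^sub>M std_exp2) F")
    case True
    have intB: "integrable (count_space UNIV) B"
      using B B0 by (simp add: integrable_count_space_nat_iff)
    have "cmod (integral\<^sup>L (count_space UNIV \<Otimes>\<^sub>M std_exp2) F) =
        cmod (\<integral> n. (\<integral> z. F (n, z) \<partial>std_exp2) \<partial>count_space UNIV)"
      by (simp add: count_exp2.integral_fst'[OF True])
    also have "\<dots> \<le> (\<integral> n. cmod (\<integral> z. F (n, z) \<partial>std_exp2) \<partial>count_space UNIV)"
      by (rule integral_norm_bound)
    also have "\<dots> \<le> (\<integral> n. B n \<partial>count_space UNIV)"
      by (rule integral_mono') (use intB bound B0 in auto)
    also have "\<dots> = (\<Sum>n. B n)"
      by (rule integral_count_space_nat[OF intB])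
    finally show ?thesis .
  next
    case False
    then show ?thesis
      using B B0 by (simp add: not_integrable_integral_eq suminf_nonneg)
  qed
qed

lemma fourier_dyadic_mixture:
  assumes "\<And>n. 0 \<le> a n"
  shows "fourier (density (dyadic_mixture a) (\<lambda>(x1, x2). ennreal (x1 ^ 4 + x2 ^ 4))) (u, v) =
    (\<integral> w. a (fst w) *\<^sub>R ((fst (snd w) / 2 ^ fst w) ^ 4 + (snd (snd w) / 2 ^ fst w) ^ 4) *\<^sub>R
        cis (u * (fst (snd w) / 2 ^ fst w) + v * (snd (snd w) / 2 ^ fst w))
      \<partial>(count_space UNIV \<Otimes>\<^sub>M std_exp2))"
proof -
  let ?e = "\<lambda>z. cis (u * fst z + v * snd z)"
  let ?h = "\<lambda>z :: real \<times> real. fst z ^ 4 + snd z ^ 4"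
  have [measurable]: "?e \<in> borel_measurable borel" "?h \<in> borel_measurable borel"
    by (auto intro!: borel_measurable_continuous_onI continuous_intros)
  have [measurable]: "(\<lambda>w. snd w /\<^sub>R 2 ^ fst w) \<in> count_space (UNIV :: nat set) \<Otimes>\<^sub>M std_exp2 \<rightarrow>\<^sub>M borel"
    by measurable
  have [measurable]: "(\<lambda>w. ?h (snd w /\<^sub>R 2 ^ fst w) *\<^sub>R ?e (snd w /\<^sub>R 2 ^ fst w))
      \<in> borel_measurable (count_space (UNIV :: nat set) \<Otimes>\<^sub>M std_exp2)"
    by (rule measurable_compose[where f="\<lambda>w. snd w /\<^sub>R 2 ^ fst w" and g="\<lambda>z. ?h z *\<^sub>R ?e z" and N=borel]) measurable
  have "fourier (density (dyadic_mixture a) (\<lambda>(x1, x2). ennreal (x1 ^ 4 + x2 ^ 4))) (u, v) =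
      (\<integral> z. ?e z \<partial>density (dyadic_mixture a) (\<lambda>z. ennreal (?h z)))"
    by (simp add: fourier_def case_prod_beta' cis_conv_exp inner_prod_def)
  also have "\<dots> = (\<integral> z. ?h z *\<^sub>R ?e z \<partial>dyadic_mixture a)"
    by (subst integral_density) auto
  also have "\<dots> = (\<integral> w. ?h (snd w /\<^sub>R 2 ^ fst w) *\<^sub>R ?e (snd w /\<^sub>R 2 ^ fst w)
      \<partial>density (count_space UNIV \<Otimes>\<^sub>M std_exp2) (\<lambda>w. ennreal (a (fst w))))"
    unfolding dyadic_mixture_def by (subst integral_distr) auto
  also have "\<dots> = (\<integral> w. a (fst w) *\<^sub>R ?h (snd w /\<^sub>R 2 ^ fst w) *\<^sub>R ?e (snd w /\<^sub>R 2 ^ fst w)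
      \<partial>(count_space UNIV \<Otimes>\<^sub>M std_exp2))"
    by (rule integral_density) (use assms in \<open>measurable, simp\<close>)
  finally show ?thesis
    by (simp add: divide_inverse mult.commute)
qed

text \<open>Fourth powers make layer \<open>n\<close> gain \<open>16 ^ n\<close>, while undoing the
  rescaling of the frequency costs \<open>2 ^ n\<close> per coordinate. What remains is the summable
  \<open>a n / 4 ^ n\<close>.\<close>

lemma norm_fourier_dyadic_mixture_le:
  assumes a: "\<And>n. 0 \<le> a n" "summable (\<lambda>n. a n / 4 ^ n)"
  shows "cmod (fourier (density (dyadic_mixture a) (\<lambda>(x1, x2). ennreal (x1 ^ 4 + x2 ^ 4))) (u, v))
    \<le> 192 * (\<Sum>n. a n / 4 ^ n) * inverse (1 + \<bar>u\<bar>) * inverse (1 + \<bar>v\<bar>)"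
proof -
  let ?C = "192 * inverse (1 + \<bar>u\<bar>) * inverse (1 + \<bar>v\<bar>)"
  have "cmod (\<integral> z. a n *\<^sub>R ((fst z / 2 ^ n) ^ 4 + (snd z / 2 ^ n) ^ 4) *\<^sub>R
        cis (u * (fst z / 2 ^ n) + v * (snd z / 2 ^ n)) \<partial>std_exp2) \<le> ?C * (a n / 4 ^ n)" (is "cmod ?I \<le> _") for n
  proof -
    have scale: "1 / (1 + \<bar>t / 2 ^ n\<bar>) \<le> 2 ^ n * inverse (1 + \<bar>t\<bar>)" for t :: real
    proof -
      have "1 + \<bar>t\<bar> \<le> 2 ^ n * (1 + \<bar>t / 2 ^ n\<bar>)"
        by (simp add: algebra_simps)
      then show ?thesis
        by (simp add: divide_le_eq le_divide_eq inverse_eq_divide mult.commute add_pos_nonneg)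
    qed
    have "?I = (a n / 16 ^ n) *\<^sub>R (\<integral> z. (fst z ^ 4 + snd z ^ 4) *\<^sub>R
        cis (u / 2 ^ n * fst z + v / 2 ^ n * snd z) \<partial>std_exp2)"
    proof -
      have "(2 ^ n) ^ 4 = (16 :: real) ^ n"
        by (simp add: power_mult[symmetric] mult.commute[of n]) (simp add: power_mult)
      then have "a n *\<^sub>R ((fst z / 2 ^ n) ^ 4 + (snd z / 2 ^ n) ^ 4) *\<^sub>R
            cis (u * (fst z / 2 ^ n) + v * (snd z / 2 ^ n)) =
          (a n / 16 ^ n) *\<^sub>R (fst z ^ 4 + snd z ^ 4) *\<^sub>R cis (u / 2 ^ n * fst z + v / 2 ^ n * snd z)"
        for z :: "real \<times> real"
        by (simp add: power_divide add_divide_distrib distrib_left)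
      then show ?thesis
        by (simp only: integral_scaleR_right)
    qed
    then have "cmod ?I \<le> a n / 16 ^ n * (192 / ((1 + \<bar>u / 2 ^ n\<bar>) * (1 + \<bar>v / 2 ^ n\<bar>)))"
      using a(1)[of n] norm_std_exp2_transform_le[of "u / 2 ^ n" "v / 2 ^ n"]
      by (simp add: mult_left_mono del: times_divide_eq_right times_divide_eq_left)
    also have "\<dots> = a n / 16 ^ n * 192 * (1 / (1 + \<bar>u / 2 ^ n\<bar>) * (1 / (1 + \<bar>v / 2 ^ n\<bar>)))"
      by simp
    also have "\<dots> \<le> a n / 16 ^ n * 192 * ((2 ^ n * inverse (1 + \<bar>u\<bar>)) * (2 ^ n * inverse (1 + \<bar>v\<bar>)))"
      using a(1)[of n] by (intro mult_left_mono mult_mono scale) auto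
    also have "\<dots> = ?C * (a n * ((2 ^ n * 2 ^ n) / 16 ^ n))"
      by simp
    also have "(2 ^ n * 2 ^ n) / 16 ^ n = 1 / (4 :: real) ^ n"
    proof -
      have "2 ^ n * 2 ^ n = (4 :: real) ^ n" "(16 :: real) ^ n = 4 ^ n * 4 ^ n"
        by (simp_all flip: power_mult_distrib)
      then show ?thesis by simp
    qed
    finally show ?thesis by simp
  qed
  then have "cmod (fourier (density (dyadic_mixture a) (\<lambda>(x1, x2). ennreal (x1 ^ 4 + x2 ^ 4))) (u, v))
      \<le> (\<Sum>n. ?C * (a n / 4 ^ n))"
    unfolding fourier_dyadic_mixture[OF a(1)]
    by (intro norm_integral_count_pair_le) (auto intro!: summable_mult a simp del: times_divide_eq_right)
  also have "\<dots> = ?C * (\<Sum>n. a n / 4 ^ n)"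
    by (rule suminf_mult[OF a(2)])
  finally show ?thesis by (simp add: mult_ac)
qed

theorem corollary3p6:
  fixes \<beta> :: real
  assumes "0 \<le> \<beta>" and "\<beta> \<le> 2"
  shows "\<exists>\<nu> :: (real \<times> real) measure.
     levy_measure \<nu> \<and> blumenthal_getoor_index \<nu> = \<beta> \<and>
     emeasure \<nu> (UNIV - {0..} \<times> {0..}) = 0 \<and>
     (\<exists>\<gamma>>0. (\<integral>\<^sup>+ x. ennreal (norm x powr (8 + \<gamma>)) \<partial>\<nu>) < \<infinity>) \<and>
     (\<exists>c>0. \<forall>u1 u2.
        cmod (fourier (density \<nu> (\<lambda>(x1, x2). ennreal (x1 ^ 4 + x2 ^ 4))) (u1, u2))
          \<le> c * inverse (1 + \<bar>u1\<bar>) * inverse (1 + \<bar>u2\<bar>)) \<and>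
     (\<forall>U \<in> {U1 \<nu>, U2 \<nu>}.
        bij_betw U {0<..} {0<..} \<and>
        (\<forall>x>0. U differentiable (at x)) \<and> continuous_on {0<..} (deriv U) \<and>
        (\<forall>x>0. deriv U x < 0) \<and>
        (INF x\<in>{0<..1}. \<bar>deriv U x\<bar>) > 0 \<and>
        bdd_above ((\<lambda>x. min 1 (x ^ 3) * \<bar>deriv U x\<bar>) ` {0<..}))"
proof (intro exI[of _ "bg_measure \<beta>"] conjI)
  show "\<exists>\<gamma>>0. (\<integral>\<^sup>+ x. ennreal (norm x powr (8 + \<gamma>)) \<partial>bg_measure \<beta>) < \<infinity>"
    \<comment> \<open>Any positive excess would do, since all moments of order above
      \<open>\<beta>\<close> are finite; 1 is taken.\<close>
    using assms bg_measure_moment_finite[of \<beta> "8 + 1"] by (intro exI[of _ 1]) auto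
  have "(\<Sum>n. bg_weight \<beta> n / 4 ^ n) > 0"
    using assms bg_weight_ge_1[of \<beta>]
    by (intro suminf_pos bg_weight_summable divide_pos_pos) (auto intro: less_le_trans[OF zero_less_one])
  \<comment> \<open>The transform is a genuine integral: the density is at most the fourth power of
    the norm, and \<open>4 > \<beta>\<close> makes that moment finite.\<close>
  then show "\<exists>c>0. \<forall>u1 u2.
      cmod (fourier (density (bg_measure \<beta>) (\<lambda>(x1, x2). ennreal (x1 ^ 4 + x2 ^ 4))) (u1, u2))
        \<le> c * inverse (1 + \<bar>u1\<bar>) * inverse (1 + \<bar>u2\<bar>)"
    using norm_fourier_dyadic_mixture_le[OF bg_weight_nonneg bg_weight_summable[OF assms(2)]]
    unfolding bg_measure_def by (intro exI[of _ "192 * (\<Sum>n. bg_weight \<beta> n / 4 ^ n)"]) auto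
  show "levy_measure (bg_measure \<beta>)" "blumenthal_getoor_index (bg_measure \<beta>) = \<beta>"
    using assms by (simp_all add: levy_measure_bg_measure index_bg_measure)
  show "emeasure (bg_measure \<beta>) (UNIV - {0..} \<times> {0..}) = 0"
    by (rule bg_measure_quadrant)
qed (rule ballI, rule dyadic_tail.tail_conditions, rule dyadic_tail_bg_measure[OF assms])

end
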